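(* Let $n\ge 1$ and let $f:\mathbb{R}^{n}\rightarrow \mathbb{R}^{n}$ be a strictly (Hadamard) differentiable mapping (i.e. strictly differentiable at every point of $\mathbb{R}^n$) such that (b1) for every $y\in \mathbb{R}^{n}$ the functional $\varphi :\mathbb{R}^{n}\rightarrow \mathbb{R}$ defined by $\varphi(x)=\frac{1}{2}\left\Vert f(x)-y\right\Vert ^{2}$ is coercive, i.e. $\varphi(x)\rightarrow \infty$ as $\left\Vert x\right\Vert \rightarrow \infty$; (b2) for every $x\in \mathbb{R}^{n}$ we have $\det [f^{\prime }(x)]\neq 0$. Then $f$ is a diffeomorphism from $\mathbb{R}^n$ onto $\mathbb{R}^n$.
   Context: $\|\cdot\|$ denotes the Euclidean norm on $\mathbb{R}^n$. Strict (Hadamard) differentiability: a mapping $f:D\to\mathbb{R}^n$, with $D\subset\mathbb{R}^n$, is strictly (Hadamard) differentiable at $x_0\in D$ if there exists a linear map $f'(x_0):\mathbb{R}^n\to\mathbb{R}^n$ (identified with an $n\times n$ matrix) such that $$\lim_{w\rightarrow x_{0},\,t\rightarrow 0^{+}}\frac{f(w+tz)-f(w)}{t}=f^{\prime }(x_{0})z\quad\text{for all } z\in \mathbb{R}^{n},$$ with the convergence uniform for $z$ in compact sets. A diffeomorphism from $\mathbb{R}^n$ onto $\mathbb{R}^n$ is a differentiable bijection whose inverse is differentiable. *)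

theory Defs
  imports "HOL-Analysis.Analysis"
begin

text \<open>The joint limit $w \to x_0$, $t \to 0^+$ is taken along the product filter below.
  The base point $w$ may equal $x_0$, so that the strict derivative in particular
  is a Hadamard derivative at $x_0$.\<close>

definition has_strict_hadamard_derivative ::
    "('a::real_normed_vector \<Rightarrow> 'b::real_normed_vector) \<Rightarrow> ('a \<Rightarrow> 'b) \<Rightarrow> 'a \<Rightarrow> bool"
  where "has_strict_hadamard_derivative f f' x0 \<longleftrightarrow>
    linear f' \<and>
    (\<forall>K. compact K \<longrightarrow>
      uniform_limit K (\<lambda>(w, t) z. (f (w + t *\<^sub>R z) - f w) /\<^sub>R t) f'
        (nhds x0 \<times>\<^sub>F at_right (0::real)))"

definition coercive :: "('a::real_normed_vector \<Rightarrow> real) \<Rightarrow> bool"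
  where "coercive \<phi> \<longleftrightarrow> filterlim \<phi> at_top at_infinity"

definition diffeomorphism :: "('a::real_normed_vector \<Rightarrow> 'b::real_normed_vector) \<Rightarrow> bool"
  where "diffeomorphism f \<longleftrightarrow>
    bij f \<and> f differentiable_on UNIV \<and> inv f differentiable_on UNIV"

end

theory Submission
  imports Defs
begin

text \<open>A strictly differentiable map with injective derivative is locally injective, hence open by
  invariance of domain; coercivity makes it proper. A proper locally injective self-map of a
  Euclidean space is a covering of the whole space, and since the space is simply connected the
  identity lifts through it, which yields a global continuous inverse.\<close>

text \<open>Every nonzero increment \<open>b - a\<close> is a positive length times a unit vector,
  so uniform convergence on the compact unit sphere controls all directions at once. Because the
  base point also varies in the limit, the bound holds for both points free near \<open>x\<close>,
  not just for increments from \<open>x\<close>.\<close>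

lemma strict_hadamard_derivative_estimate:
  fixes f :: "'a::euclidean_space \<Rightarrow> 'b::real_normed_vector"
  assumes f: "has_strict_hadamard_derivative f f' x" and "0 < e"
  obtains d where "0 < d"
    "\<And>a b. a \<in> ball x d \<Longrightarrow> b \<in> ball x d \<Longrightarrow> norm (f b - f a - f' (b - a)) \<le> e * norm (b - a)"
proof -
  interpret linear f' using f by (simp add: has_strict_hadamard_derivative_def)
  have "uniform_limit (sphere 0 1) (\<lambda>(w, t) z. (f (w + t *\<^sub>R z) - f w) /\<^sub>R t) f'
      (nhds x \<times>\<^sub>F at_right (0::real))"
    using f by (simp add: has_strict_hadamard_derivative_def)
  then have "\<forall>\<^sub>F p in nhds x \<times>\<^sub>F at_right (0::real). \<forall>z\<in>sphere 0 1.
      dist ((case p of (w, t) \<Rightarrow> \<lambda>z. (f (w + t *\<^sub>R z) - f w) /\<^sub>R t) z) (f' z) < e"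
    using \<open>0 < e\<close> by (auto simp: uniform_limit_iff)
  then obtain P Q where P: "eventually P (nhds x)" and Q: "eventually Q (at_right (0::real))"
    and PQ: "\<And>w t z. P w \<Longrightarrow> Q t \<Longrightarrow> norm z = 1 \<Longrightarrow>
      norm ((f (w + t *\<^sub>R z) - f w) /\<^sub>R t - f' z) < e"
    by (fastforce simp: eventually_prod_filter dist_norm)
  obtain d1 where d1: "d1 > 0" "\<And>w. dist w x < d1 \<Longrightarrow> P w"
    using P by (auto simp: eventually_nhds_metric)
  obtain d2 where d2: "d2 > 0" "\<And>t. 0 < t \<Longrightarrow> t < d2 \<Longrightarrow> Q t"
    using Q by (auto simp: eventually_at_right_field)
  show thesis
  proof
    \<comment> \<open>Halving \<open>d2\<close> keeps the distance of any two points of the ball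
      below \<open>d2\<close>, so that distance is an admissible step length \<open>t\<close>;
      \<open>d1\<close> makes \<open>a\<close> an admissible base point.\<close>
    show "0 < min d1 (d2 / 2)" using d1 d2 by simp
    fix a b assume ab: "a \<in> ball x (min d1 (d2 / 2))" "b \<in> ball x (min d1 (d2 / 2))"
    show "norm (f b - f a - f' (b - a)) \<le> e * norm (b - a)"
    proof (cases "a = b")
      case True
      then show ?thesis by (simp add: zero)
    next
      case False
      define t where "t = norm (b - a)"
      define z where "z = (b - a) /\<^sub>R t"
      have t: "0 < t" using False by (simp add: t_def)
      have "dist b a < d2"
        using ab dist_triangle_half_r[of x b d2 a] by (auto simp: dist_commute)
      then have "Q t" using t d2 by (simp add: t_def dist_norm)
      moreover have "P a" using ab d1 by (auto simp: dist_commute)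
      moreover have "norm z = 1" using t by (simp add: z_def t_def)
      ultimately have "norm ((f (a + t *\<^sub>R z) - f a) /\<^sub>R t - f' z) < e" using PQ by blast
      moreover have tz: "t *\<^sub>R z = b - a" using t by (simp add: z_def)
      moreover have "f b - f a - f' (b - a) = t *\<^sub>R ((f (a + t *\<^sub>R z) - f a) /\<^sub>R t - f' z)"
        using t by (simp add: algebra_simps flip: tz scale) (simp add: tz)
      ultimately show ?thesis
        using t by (simp add: t_def[symmetric] mult.commute mult_left_mono)
    qed
  qed
qed

lemma strict_hadamard_derivative_imp_has_derivative:
  fixes f :: "'a::euclidean_space \<Rightarrow> 'b::real_normed_vector"
  assumes f: "has_strict_hadamard_derivative f f' x"
  shows "(f has_derivative f') (at x)"
  unfolding has_derivative_at_alt
proof (intro conjI allI impI)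
  show "bounded_linear f'"
    using f by (simp add: has_strict_hadamard_derivative_def linear_conv_bounded_linear)
  fix e :: real assume "e > 0"
  then obtain d where d: "0 < d"
    "\<And>a b. a \<in> ball x d \<Longrightarrow> b \<in> ball x d \<Longrightarrow> norm (f b - f a - f' (b - a)) \<le> e * norm (b - a)"
    using strict_hadamard_derivative_estimate[OF f] by blast
  with d show "\<exists>d>0. \<forall>y. norm (y - x) < d \<longrightarrow> norm (f y - f x - f' (y - x)) \<le> e * norm (y - x)"
    by (metis centre_in_ball dist_commute dist_norm mem_ball)
qed

text \<open>An injective linear map in finite dimension stretches every vector by at least some
  \<open>B > 0\<close>. With linearization error at most \<open>B / 2\<close> times the increment,
  the images of distinct nearby points cannot coincide.\<close>

lemma strict_hadamard_derivative_imp_locally_inj: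
  fixes f :: "'a::euclidean_space \<Rightarrow> 'b::euclidean_space"
  assumes f: "has_strict_hadamard_derivative f f' x" and "inj f'"
  obtains d where "0 < d" "inj_on f (ball x d)"
proof -
  obtain B where B: "B > 0" "\<And>v. B * norm v \<le> norm (f' v)"
    using linear_inj_bounded_below_pos f \<open>inj f'\<close> has_strict_hadamard_derivative_def by blast
  obtain d where d: "0 < d" "\<And>a b. a \<in> ball x d \<Longrightarrow> b \<in> ball x d \<Longrightarrow>
      norm (f b - f a - f' (b - a)) \<le> B / 2 * norm (b - a)"
    using strict_hadamard_derivative_estimate[OF f] B(1) half_gt_zero by blast
  have "inj_on f (ball x d)"
  proof (rule inj_onI)
    fix a b assume "a \<in> ball x d" "b \<in> ball x d" "f a = f b"
    then have "norm (f' (b - a)) \<le> B / 2 * norm (b - a)"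
      using d(2)[of a b] by simp
    then have "B * norm (b - a) \<le> B / 2 * norm (b - a)"
      using B(2) order_trans by blast
    then show "a = b" using B(1) by (auto simp: field_simps)
  qed
  with d(1) show thesis by (rule that)
qed

text \<open>This serves twice below: for the range of the map, and for the image of what lies
  outside the balls around a fibre.\<close>

lemma proper_imp_closed_map:
  fixes f :: "'a::heine_borel \<Rightarrow> 'b::heine_borel"
  assumes proper: "\<And>K. compact K \<Longrightarrow> compact (f -` K)" and "closed C"
  shows "closed (f ` C)"
proof -
  have "closedin (top_of_set UNIV) (f ` C)"
    by (rule proper_map[of UNIV C UNIV f]) (use assms in auto)
  then show ?thesis by simp
qed

lemma proper_locally_inj_imp_covering_space:
  fixes f :: "'a::euclidean_space \<Rightarrow> 'a"
  assumes contf: "continuous_on UNIV f"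
    and proper: "\<And>K. compact K \<Longrightarrow> compact (f -` K)"
    and linj: "\<And>x. \<exists>d>0. inj_on f (ball x d)"
  shows "covering_space UNIV f UNIV"
proof
  have cont: "continuous_on S f" for S
    using contf continuous_on_subset by blast
  \<comment> \<open>Invariance of domain needs injectivity, so it is applied to the trace of
    \<open>U\<close> on a small ball around each of its points.\<close>
  have openf: "open (f ` U)" if "open U" for U
    unfolding open_subopen[of "f ` U"]
  proof clarify
    fix x assume "x \<in> U"
    obtain d where d: "d > 0" "inj_on f (ball x d)" using linj by blast
    have "open (f ` (U \<inter> ball x d))"
      using that inj_on_subset[OF d(2)] by (intro invariance_of_domain cont) auto
    then show "\<exists>T. open T \<and> f x \<in> T \<and> T \<subseteq> f ` U"
      using \<open>x \<in> U\<close> d(1) by (intro exI[of _ "f ` (U \<inter> ball x d)"]) auto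
  qed
  show "continuous_on UNIV f" by (rule contf)
  \<comment> \<open>The range is nonempty, open and closed, and the space is connected.\<close>
  show "range f = UNIV"
    using clopen[of "range f"] openf proper_imp_closed_map[OF proper] by auto
  fix y :: 'a
  define F where "F = f -` {y}"
  \<comment> \<open>A ball on which \<open>f\<close> is injective meets the fibre at most once, so
    the fibre has no limit point; being compact by properness, it is finite.\<close>
  have "\<not> x islimpt F" for x
  proof
    assume lim: "x islimpt F"
    obtain d where d: "d > 0" "inj_on f (ball x d)" using linj by blast
    have "infinite (F \<inter> ball x d)"
      using lim d(1) by (auto simp: islimpt_eq_infinite_ball)
    moreover have "finite (F \<inter> ball x d)"
      using inj_on_subset[OF d(2)] by (rule inj_on_finite[of f _ "{y}"]) (auto simp: F_def)
    ultimately show False by blast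
  qed
  then have finF: "finite F"
    using finite_not_islimpt_in_compact[of F F] proper by (simp add: F_def)
  then obtain e where e: "e > 0" and sep: "\<And>x x'. x \<in> F \<Longrightarrow> x' \<in> F \<Longrightarrow> x \<noteq> x' \<Longrightarrow> e \<le> dist x x'"
    using uniform_discrete_finite_iff[of F] by (auto simp: uniform_discrete_def not_less[symmetric])
  obtain r where r: "\<And>x. r x > 0" "\<And>x. inj_on f (ball x (r x))"
    using linj by metis
  \<comment> \<open>Radius at most \<open>e / 2\<close> makes the balls around distinct fibre points
    disjoint, and \<open>r x\<close> makes \<open>f\<close> injective on each.\<close>
  define B where "B x = ball x (min (e / 2) (r x))" for x
  have openB: "open (B x)" and injB: "inj_on f (B x)" and inB: "x \<in> B x" for x
    using r(1)[of x] inj_on_subset[OF r(2)[of x], of "B x"] e by (auto simp: B_def subset_ball min_def)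
  have disjB: "disjnt (B x) (B x')" if "x \<in> F" "x' \<in> F" "x \<noteq> x'" for x x'
  proof -
    have "dist x x' < e" if "z \<in> B x" "z \<in> B x'" for z
      using that dist_triangle_half_l[of x z e x'] by (auto simp: B_def dist_commute)
    then show ?thesis using sep[OF that] by (fastforce simp: disjnt_iff)
  qed
  define T where "T = (- f ` (- (\<Union>x\<in>F. B x))) \<inter> (\<Inter>x\<in>F. f ` B x)"
  have "closed (f ` (- (\<Union>x\<in>F. B x)))"
    by (rule proper_imp_closed_map[OF proper]) (use openB in auto)
  then have "open T"
    unfolding T_def using finF openB openf by (intro open_Int open_INT ballI open_Compl) auto
  have yT: "y \<in> T" using inB by (auto simp: T_def F_def)
  let ?V = "(\<lambda>x. B x \<inter> f -` T) ` F"
  have open_piece: "open (B x \<inter> f -` T)" for x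
    using openB \<open>open T\<close> contf by (intro open_Int open_vimage) auto
  have "\<Union>?V = UNIV \<inter> f -` T" by (auto simp: T_def)
  moreover have "pairwise disjnt ?V"
    using disjB by (fastforce simp: pairwise_def disjnt_iff)
  moreover have "\<exists>q. homeomorphism u T f q" if u: "u \<in> ?V" for u
  proof -
    obtain x where x: "x \<in> F" "u = B x \<inter> f -` T" using u by blast
    have "T \<subseteq> f ` B x" using x(1) by (auto simp: T_def)
    then have "f ` u = T" unfolding x(2) by blast
    moreover obtain q where "homeomorphism u (f ` u) f q"
      using invariance_of_domain_homeomorphism[of u f] x(2) open_piece cont injB
      by (metis inf_le1 inj_on_subset order_refl)
    ultimately show ?thesis by metis
  qed
  ultimately show "\<exists>T. y \<in> T \<and> openin (top_of_set UNIV) T \<and>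
      (\<exists>v. \<Union>v = UNIV \<inter> f -` T \<and> (\<forall>u\<in>v. openin (top_of_set UNIV) u) \<and>
        pairwise disjnt v \<and> (\<forall>u\<in>v. \<exists>q. homeomorphism u T f q))"
    using \<open>open T\<close> yT open_piece by (intro exI[of _ T] conjI exI[of _ ?V]) auto
qed

text \<open>Lifting the identity of the simply connected base gives a continuous right inverse
  \<open>g\<close>. Both \<open>g \<circ> p\<close> and the identity lift \<open>p\<close> through
  itself, so on the connected total space agreement at one point makes them equal.\<close>

lemma covering_space_UNIV_imp_homeomorphism:
  fixes p :: "'a::real_normed_vector \<Rightarrow> 'b::real_normed_vector"
  assumes cov: "covering_space UNIV p UNIV"
  obtains g where "homeomorphism UNIV UNIV p g"
proof -
  have contp: "continuous_on UNIV p" by (rule covering_space_imp_continuous[OF cov])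
  obtain g where contg: "continuous_on UNIV g" and pg: "\<And>y. p (g y) = y"
    using covering_space_lift[OF cov, of UNIV id] locally_path_connected_UNIV
      contractible_imp_simply_connected[OF contractible_UNIV]
    by (metis UNIV_I id_apply continuous_on_id' id_def Pi_I)
  \<comment> \<open>Any point of the form \<open>g y\<close> works, since
    \<open>p (g y) = y\<close>.\<close>
  obtain a where a: "g (p a) = a"
    using pg by metis
  have "continuous_on UNIV (g \<circ> p)"
    using continuous_on_compose[OF contp] continuous_on_subset[OF contg] by blast
  then have "(g \<circ> p) x = id x" for x
    by (intro covering_space_lift_unique[OF cov, of "g \<circ> p" a id UNIV p x])
      (simp_all add: a pg contp convex_connected)
  then have gp: "g (p x) = x" for x by simp
  have "homeomorphism UNIV UNIV p g"
    by (rule homeomorphismI) (use contp contg gp pg in auto)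
  then show thesis by (rule that)
qed

lemma coercive_imp_proper:
  fixes f :: "'a::euclidean_space \<Rightarrow> 'b::real_normed_vector"
  assumes contf: "continuous_on UNIV f" and coer: "coercive (\<lambda>x. 1 / 2 * (norm (f x))\<^sup>2)"
    and K: "compact K"
  shows "compact (f -` K)"
proof -
  obtain c where c: "\<And>y. y \<in> K \<Longrightarrow> norm y \<le> c"
    using compact_imp_bounded[OF K] by (auto simp: bounded_iff)
  \<comment> \<open>Beyond this threshold the squared norm of \<open>f x\<close> exceeds
    \<open>2 * c\<^sup>2\<close>, whereas values in \<open>K\<close> allow at most
    \<open>c\<^sup>2\<close>.\<close>
  have "\<forall>\<^sub>F x in at_infinity. c\<^sup>2 < 1 / 2 * (norm (f x))\<^sup>2"
    using coer by (simp add: coercive_def filterlim_at_top_dense)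
  then obtain R where R: "\<And>x. R \<le> norm x \<Longrightarrow> c\<^sup>2 < 1 / 2 * (norm (f x))\<^sup>2"
    by (auto simp: eventually_at_infinity)
  have "norm x \<le> R" if "f x \<in> K" for x
  proof (rule ccontr)
    assume "\<not> norm x \<le> R"
    then have "c\<^sup>2 < 1 / 2 * (norm (f x))\<^sup>2" by (intro R) simp
    moreover have "(norm (f x))\<^sup>2 \<le> c\<^sup>2" using c[OF that] by (intro power_mono) auto
    moreover have "0 \<le> (norm (f x))\<^sup>2" by simp
    ultimately show False by linarith
  qed
  then have "bounded (f -` K)" by (auto simp: bounded_iff)
  moreover have "closed (f -` K)"
    using closed_vimage[OF compact_imp_closed[OF K] contf] by simp
  ultimately show ?thesis by (simp add: compact_eq_bounded_closed)
qed

theorem theorem4: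
  fixes f :: "real ^ 'n \<Rightarrow> real ^ 'n"
    and f' :: "real ^ 'n \<Rightarrow> real ^ 'n \<Rightarrow> real ^ 'n"
  assumes strict: "\<And>x. has_strict_hadamard_derivative f (f' x) x"
    and b1: "\<And>y. coercive (\<lambda>x. 1 / 2 * (norm (f x - y))\<^sup>2)"
    and b2: "\<And>x. det (matrix (f' x)) \<noteq> 0"
  shows "diffeomorphism f"
proof -
  have lin: "linear (f' x)" for x
    using strict by (simp add: has_strict_hadamard_derivative_def)
  have inj: "inj (f' x)" for x
    using b2 lin det_nz_iff_inj by blast
  have der: "(f has_derivative f' x) (at x)" for x
    by (rule strict_hadamard_derivative_imp_has_derivative[OF strict])
  then have contf: "continuous_on UNIV f"
    by (metis has_derivative_continuous continuous_at_imp_continuous_on)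
  have "covering_space UNIV f UNIV"
  proof (rule proper_locally_inj_imp_covering_space)
    show "compact (f -` K)" if "compact K" for K
      using b1[of 0] contf that by (intro coercive_imp_proper) simp_all
    show "\<exists>d>0. inj_on f (ball x d)" for x
      using strict_hadamard_derivative_imp_locally_inj[OF strict inj] by blast
  qed (rule contf)
  then obtain g where g: "homeomorphism UNIV UNIV f g"
    by (rule covering_space_UNIV_imp_homeomorphism)
  then have gf: "\<And>x. g (f x) = x" and fg: "\<And>y. f (g y) = y" and contg: "continuous_on UNIV g"
    by (auto simp: homeomorphism_def)
  have "g differentiable at y" for y
  proof -
    \<comment> \<open>The candidate derivative of \<open>g\<close> at \<open>y\<close> is the
      inverse of \<open>f' (g y)\<close>. Continuity of \<open>g\<close> together with
      \<open>f (g z) = z\<close> for all \<open>z\<close> then yields differentiability.\<close>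
    obtain h where h: "linear h" "h \<circ> f' (g y) = id"
      using linear_injective_left_inverse[OF lin inj] by blast
    have "(g has_derivative h) (at y)"
      using h contg fg
      by (intro has_derivative_inverse_basic[OF der, where T = UNIV])
        (auto simp: linear_conv_bounded_linear continuous_on_eq_continuous_at)
    then show ?thesis by (rule differentiableI)
  qed
  moreover have "inv f = g"
    using gf fg by (intro inv_unique_comp) (simp_all add: fun_eq_iff)
  moreover have "bij f"
    using gf fg by (intro o_bij[of g]) (simp_all add: fun_eq_iff)
  ultimately show ?thesis
    using differentiableI[OF der] by (simp add: diffeomorphism_def differentiable_on_def)
qed

end
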